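(* Let $\mathcal{P}=\mathcal{P}_{(\boldsymbol{\mu},\boldsymbol{\sigma})}$ be the mean-dispersion ambiguity set $$\mathcal{P}_{(\boldsymbol{\mu},\boldsymbol{\sigma})}=\{\mathbb{P}\in\mathcal{P}_0(\mathbb{R}^n):\ \mathbb{E}_{\mathbb{P}}[\mathbf{X}]=\boldsymbol{\mu},\ \mathbb{E}_{\mathbb{P}}[\mathbf{d}(\mathbf{X})]\preceq_{\mathcal{D}}\boldsymbol{\sigma}\},$$ and suppose that: (C1) the side-information set $\Xi\subseteq\mathbb{R}^n$ is closed and convex with $\inf_{\mathbb{P}\in\mathcal{P}}\mathbb{P}(\mathbf{X}\in\Xi)>0$, and the support set is $\mathcal{X}=\mathbb{R}^n$; (C2) $\mathbf{d}:\mathbb{R}^n\to\mathbb{R}^m$ is $\mathcal{D}$-convex with conic representable $\mathcal{D}$-epigraph $\{(\mathbf{x},\mathbf{u}):\mathbf{d}(\mathbf{x})\preceq_{\mathcal{D}}\mathbf{u}\}$, where $\mathcal{D}\subseteq\mathbb{R}^m$ is a proper cone; (C3) $f(\boldsymbol{\nu},\mathbf{x})=\max_{l\in\mathcal{L}}\{\mathbf{s}_l(\boldsymbol{\nu})^\top\mathbf{x}+t_l(\boldsymbol{\nu})\}$, where $\mathcal{L}$ is an index set and, for all $l\in\mathcal{L}$, $\mathbf{s}_l(\cdot)\in\mathbb{R}^n$ and $t_l(\cdot)\in\mathbb{R}$ are affine functions of $\boldsymbol{\nu}$; (C4) the Slater condition $\boldsymbol{\mu}\in\operatorname{int}(\mathcal{X})$,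 $\mathbf{d}(\boldsymbol{\mu})\prec_{\mathcal{D}}\boldsymbol{\sigma}$ holds. Then the optimal value of the contextual distributionally robust optimization problem $$\inf_{\boldsymbol{\nu}\in\mathcal{V}}\ \sup_{\mathbb{P}\in\mathcal{P}}\ \mathbb{E}_{\mathbb{P}}[f(\boldsymbol{\nu},\mathbf{X})\mid\mathbf{X}\in\Xi]$$ coincides with the optimal value of the semi-infinite linear program $$\begin{aligned} \inf_{\boldsymbol{\nu},\lambda_0,\boldsymbol{\lambda}_1,\boldsymbol{\lambda}_2,\lambda_3}\ &\lambda_3\\ \text{s.t. }\ &\lambda_0+\boldsymbol{\lambda}_1^\top\boldsymbol{\mu}+\boldsymbol{\lambda}_2^\top\boldsymbol{\sigma}\le0,\\ &\lambda_0+\boldsymbol{\lambda}_1^\top\mathbf{x}+\boldsymbol{\lambda}_2^\top\mathbf{u}\ge0,\quad\forall(\mathbf{x},\mathbf{u})\in\overline{\mathcal{C}},\\ &\lambda_0+\boldsymbol{\lambda}_1^\top\mathbf{x}+\boldsymbol{\lambda}_2^\top\mathbf{u}+\lambda_3\ge\mathbf{s}_l(\boldsymbol{\nu})^\top\mathbf{x}+t_l(\boldsymbol{\nu}),\quad\forall(\mathbf{x},\mathbf{u})\in\mathcal{C},\ \forall l\in\mathcal{L},\\ &\boldsymbol{\nu}\in\mathcal{V},\ \lambda_0\in\mathbb{R},\ \boldsymbol{\lambda}_1\in\mathbb{R}^n,\ \boldsymbol{\lambda}_2\in\mathcal{D}^*,\ \lambda_3\in\mathbb{R}, \end{aligned}$$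 where $$\mathcal{C}=\{(\mathbf{x},\mathbf{u})\in\mathbb{R}^n\times\mathbb{R}^m:\mathbf{x}\in\Xi,\ \mathbf{d}(\mathbf{x})\preceq_{\mathcal{D}}\mathbf{u}\},\qquad\overline{\mathcal{C}}=\operatorname{conv}\big(\{(\mathbf{x},\mathbf{u})\in\mathbb{R}^n\times\mathbb{R}^m:\mathbf{x}\in\overline{\Xi},\ \mathbf{d}(\mathbf{x})=\mathbf{u}\}\big),$$ and $\overline{\Xi}:=\operatorname{cl}(\mathbb{R}^n\setminus\Xi)$. Moreover, suppose additionally that $\mathcal{L}$ is finite, that the cones $$\mathcal{K}=\operatorname{cl}\{(\mathbf{x},\mathbf{u},w):(\mathbf{x}/w,\mathbf{u}/w)\in\mathcal{C},\ w>0\},\qquad\overline{\mathcal{K}}=\operatorname{cl}\{(\mathbf{x},\mathbf{u},w):(\mathbf{x}/w,\mathbf{u}/w)\in\overline{\mathcal{C}},\ w>0\}$$ are proper and, together with their dual cones, conic representable, and that each contains a point of the form $(\mathbf{x},\mathbf{u},1)$ in its interior. Then the semi-infinite linear program admits a reformulation as a finite-dimensional conic optimization problem.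
   Context: $\mathcal{V}\subseteq\mathbb{R}^p$ is a closed convex set of decisions. $\mathcal{P}_0(\mathbb{R}^n)$ is the set of probability distributions on $\mathbb{R}^n$; $\mathbf{X}=(\mathbf{Y},\mathbf{Z})$ is a random vector in $\mathbb{R}^n=\mathbb{R}^{n_y}\times\mathbb{R}^{n_z}$ with law $\mathbb{P}$, consisting of outcome variables $\mathbf{Y}$ and covariates $\mathbf{Z}$, and the side information has the form $\Xi=\{(\mathbf{y},\mathbf{z}):\mathbf{z}\in\Xi_{\mathbf{z}}\}$ for a set $\Xi_{\mathbf{z}}\subseteq\mathbb{R}^{n_z}$. $\boldsymbol{\mu}\in\mathbb{R}^n$, $\boldsymbol{\sigma}\in\mathbb{R}^m$. The conditional expectation is $\mathbb{E}_{\mathbb{P}}[F(\mathbf{X})\mid\mathbf{X}\in\Xi]=\mathbb{E}_{\mathbb{P}}[F(\mathbf{X})\mathbf{1}_\Xi(\mathbf{X})]/\mathbb{P}(\mathbf{X}\in\Xi)$. A proper cone is a closed, convex, pointed cone with nonempty interior. $\mathbf{x}\preceq_{\mathcal{D}}\mathbf{u}$ means $\mathbf{u}-\mathbf{x}\in\mathcal{D}$, and $\mathbf{x}\prec_{\mathcal{D}}\mathbf{u}$ means $\mathbf{u}-\mathbf{x}\in\operatorname{int}(\mathcal{D})$. $\mathbf{d}$ is $\mathcal{D}$-convex if $\mathbf{d}(\theta\mathbf{x}_1+(1-\theta)\mathbf{x}_2)\preceq_{\mathcal{D}}\theta\mathbf{d}(\mathbf{x}_1)+(1-\theta)\mathbf{d}(\mathbf{x}_2)$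 for all $\mathbf{x}_1,\mathbf{x}_2$ and $\theta\in[0,1]$. $\mathcal{D}^*=\{\mathbf{v}:\mathbf{v}^\top\mathbf{u}\ge0\ \forall\mathbf{u}\in\mathcal{D}\}$ is the dual cone. A set is conic representable if it can be described by finitely many conic inequalities $\mathbf{A}\mathbf{x}+\mathbf{B}\mathbf{v}+\mathbf{b}\in\mathcal{K}'$ with $\mathcal{K}'$ proper cones, possibly using auxiliary variables $\mathbf{v}$. $\operatorname{conv}$, $\operatorname{cl}$, $\operatorname{int}$ denote convex hull, closure and interior. "Admits a reformulation as a finite-dimensional conic optimization problem" means: the feasible set of the semi-infinite program is the set of all $(\boldsymbol{\nu},\lambda_0,\boldsymbol{\lambda}_1,\boldsymbol{\lambda}_2,\lambda_3)$ with $\boldsymbol{\nu}\in\mathcal{V}$ for which there exist finitely many auxiliary real variables satisfying, jointly with them, a finite system of affine equations, affine inequalities and affine conic membership constraints (with respect to the cones $\mathcal{D}^*$, $\mathcal{K}^*$, $\overline{\mathcal{K}}^*$). *)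

theory Defs
  imports "HOL-Analysis.Analysis" "HOL-Probability.Probability"
begin

section \<open>Cones and generalized inequalities\<close>

definition pointed :: "'a::real_vector set \<Rightarrow> bool" where
  "pointed K \<longleftrightarrow> (\<forall>x\<in>K. - x \<in> K \<longrightarrow> x = 0)"

definition proper_cone :: "'a::euclidean_space set \<Rightarrow> bool" where
  "proper_cone K \<longleftrightarrow> closed K \<and> convex K \<and> cone K \<and> pointed K \<and> interior K \<noteq> {}"

definition dual_cone :: "'a::real_inner set \<Rightarrow> 'a set" where
  "dual_cone K = {v. \<forall>u\<in>K. 0 \<le> v \<bullet> u}"

definition cone_le :: "'a::euclidean_space set \<Rightarrow> 'a \<Rightarrow> 'a \<Rightarrow> bool" where
  "cone_le D x u \<longleftrightarrow> u - x \<in> D"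

definition cone_less :: "'a::euclidean_space set \<Rightarrow> 'a \<Rightarrow> 'a \<Rightarrow> bool" where
  "cone_less D x u \<longleftrightarrow> u - x \<in> interior D"

definition cone_convex :: "'b::euclidean_space set \<Rightarrow> ('a::real_vector \<Rightarrow> 'b) \<Rightarrow> bool" where
  "cone_convex D d \<longleftrightarrow> (\<forall>x1 x2. \<forall>\<theta>\<in>{0..1}.
     cone_le D (d (\<theta> *\<^sub>R x1 + (1 - \<theta>) *\<^sub>R x2)) (\<theta> *\<^sub>R d x1 + (1 - \<theta>) *\<^sub>R d x2))"

definition cone_epigraph :: "'b::euclidean_space set \<Rightarrow> ('a \<Rightarrow> 'b) \<Rightarrow> ('a \<times> 'b) set" where
  "cone_epigraph D d = {(x, u). cone_le D (d x) u}"


section \<open>Affine functions and conic representability\<close>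

definition affine_map :: "('a::real_vector \<Rightarrow> 'b::real_vector) \<Rightarrow> bool" where
  "affine_map g \<longleftrightarrow> (\<exists>A b. linear A \<and> (\<forall>x. g x = A x + b))"

text \<open>Joint affine dependence on \<open>x\<close> and on \<open>q\<close> auxiliary real variables
  \<open>v 0, \<dots>, v (q - 1)\<close>; the remaining values of \<open>v\<close> are irrelevant.\<close>

definition affine_aux :: "nat \<Rightarrow> ('a::real_vector \<Rightarrow> (nat \<Rightarrow> real) \<Rightarrow> 'b::real_vector) \<Rightarrow> bool" where
  "affine_aux q g \<longleftrightarrow>
     (\<exists>A B b. linear A \<and> (\<forall>x v. g x v = A x + (\<Sum>r<q. v r *\<^sub>R B r) + b))"

text \<open>Since the dimensions of the cones used in a conic representation are existentially
  quantified, these cones live in \<^const>\<open>Euclidean_space\<close> \<open>k\<close>, i.e. $R^k$ realized as the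
  functions \<open>nat \<Rightarrow> real\<close> vanishing at all \<open>i \<ge> k\<close>.\<close>

definition proper_cone_dim :: "nat \<Rightarrow> (nat \<Rightarrow> real) set \<Rightarrow> bool" where
  "proper_cone_dim k K \<longleftrightarrow>
     closedin (Euclidean_space k) K \<and>
     (\<forall>x\<in>K. \<forall>y\<in>K. \<forall>\<theta>\<in>{0..1}. (\<lambda>i. \<theta> * x i + (1 - \<theta>) * y i) \<in> K) \<and>
     (\<forall>x\<in>K. \<forall>c\<ge>0. (\<lambda>i. c * x i) \<in> K) \<and>
     (\<forall>x\<in>K. (\<lambda>i. - x i) \<in> K \<longrightarrow> x = (\<lambda>i. 0)) \<and>
     (Euclidean_space k) interior_of K \<noteq> {}"

text \<open>\<open>S\<close> is described by \<open>N\<close> conic inequalities with auxiliary variables \<open>v\<close>; the \<open>i\<close>-th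
  coordinate of the \<open>j\<close>-th expression \<open>A x + B v + b\<close> is \<open>g j i x v\<close>.\<close>

definition conic_representable :: "'a::euclidean_space set \<Rightarrow> bool" where
  "conic_representable S \<longleftrightarrow>
     (\<exists>(q::nat) (N::nat) (k :: nat \<Rightarrow> nat) (K :: nat \<Rightarrow> (nat \<Rightarrow> real) set)
        (g :: nat \<Rightarrow> nat \<Rightarrow> 'a \<Rightarrow> (nat \<Rightarrow> real) \<Rightarrow> real).
        (\<forall>j<N. proper_cone_dim (k j) (K j)) \<and>
        (\<forall>j<N. \<forall>i<k j. affine_aux q (g j i)) \<and>
        S = {x. \<exists>v. \<forall>j<N. (\<lambda>i. if i < k j then g j i x v else 0) \<in> K j})"


section \<open>Ambiguity set and conditional expectation\<close>

definition borel_probs :: "'a::euclidean_space measure set" where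
  "borel_probs = {P. prob_space P \<and> sets P = sets borel}"

text \<open>An expectation constraint is read as including the existence of the (finite) expectation;
  note that the Bochner integral of a non-integrable function is \<open>0\<close> by convention.\<close>

definition mean_dispersion_set ::
  "'b::euclidean_space set \<Rightarrow> ('a::euclidean_space \<Rightarrow> 'b) \<Rightarrow> 'a \<Rightarrow> 'b \<Rightarrow> 'a measure set" where
  "mean_dispersion_set D d \<mu> \<sigma> =
     {P \<in> borel_probs.
        integrable P (\<lambda>x. x) \<and> integral\<^sup>L P (\<lambda>x. x) = \<mu> \<and>
        integrable P d \<and> cone_le D (integral\<^sup>L P d) \<sigma>}"

text \<open>Expectation with values in the extended reals. A maximum of infinitely many affine functions
  can have expectation \<open>\<infinity>\<close>. Its negative part, however, is integrable under every distribution
  with finite mean, so the meaningless case \<open>\<infinity> - \<infinity>\<close> does not occur below.\<close>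

definition ext_expectation :: "'a measure \<Rightarrow> ('a \<Rightarrow> real) \<Rightarrow> ereal" where
  "ext_expectation P F =
     enn2ereal (\<integral>\<^sup>+x. ennreal (F x) \<partial>P) - enn2ereal (\<integral>\<^sup>+x. ennreal (- F x) \<partial>P)"

definition cond_expectation :: "'a measure \<Rightarrow> ('a \<Rightarrow> real) \<Rightarrow> 'a set \<Rightarrow> ereal" where
  "cond_expectation P F \<Xi> =
     ext_expectation P (\<lambda>x. F x * indicator \<Xi> x) / ereal (measure P \<Xi>)"


section \<open>The two optimization problems\<close>

definition cdro_value ::
  "'v set \<Rightarrow> 'a measure set \<Rightarrow> ('v \<Rightarrow> 'a \<Rightarrow> real) \<Rightarrow> 'a set \<Rightarrow> ereal" where
  "cdro_value V \<P> f \<Xi> = (INF \<nu>\<in>V. SUP P\<in>\<P>. cond_expectation P (f \<nu>) \<Xi>)"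

definition C_set ::
  "'b::euclidean_space set \<Rightarrow> ('a::euclidean_space \<Rightarrow> 'b) \<Rightarrow> 'a set \<Rightarrow> ('a \<times> 'b) set" where
  "C_set D d \<Xi> = {(x, u). x \<in> \<Xi> \<and> cone_le D (d x) u}"

definition Cbar_set ::
  "('a::euclidean_space \<Rightarrow> 'b::euclidean_space) \<Rightarrow> 'a set \<Rightarrow> ('a \<times> 'b) set" where
  "Cbar_set d \<Xi> = convex hull {(x, u). x \<in> closure (UNIV - \<Xi>) \<and> d x = u}"

text \<open>The variables are \<open>(\<nu>, l0, l1, l2, l3)\<close>, the \<open>li\<close> being the multipliers.\<close>

definition silp_feasible ::
  "'v set \<Rightarrow> 'l set \<Rightarrow> ('l \<Rightarrow> 'v \<Rightarrow> 'a::euclidean_space) \<Rightarrow> ('l \<Rightarrow> 'v \<Rightarrow> real) \<Rightarrow>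
   'b::euclidean_space set \<Rightarrow> ('a \<Rightarrow> 'b) \<Rightarrow> 'a set \<Rightarrow> 'a \<Rightarrow> 'b \<Rightarrow>
   ('v \<times> real \<times> 'a \<times> 'b \<times> real) set" where
  "silp_feasible V L s t D d \<Xi> \<mu> \<sigma> =
     {(\<nu>, l0, l1, l2, l3).
        l0 + l1 \<bullet> \<mu> + l2 \<bullet> \<sigma> \<le> 0 \<and>
        (\<forall>(x, u) \<in> Cbar_set d \<Xi>. l0 + l1 \<bullet> x + l2 \<bullet> u \<ge> 0) \<and>
        (\<forall>(x, u) \<in> C_set D d \<Xi>. \<forall>l\<in>L. l0 + l1 \<bullet> x + l2 \<bullet> u + l3 \<ge> s l \<nu> \<bullet> x + t l \<nu>) \<and>
        \<nu> \<in> V \<and> l2 \<in> dual_cone D}"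

definition silp_value ::
  "'v set \<Rightarrow> 'l set \<Rightarrow> ('l \<Rightarrow> 'v \<Rightarrow> 'a::euclidean_space) \<Rightarrow> ('l \<Rightarrow> 'v \<Rightarrow> real) \<Rightarrow>
   'b::euclidean_space set \<Rightarrow> ('a \<Rightarrow> 'b) \<Rightarrow> 'a set \<Rightarrow> 'a \<Rightarrow> 'b \<Rightarrow> ereal" where
  "silp_value V L s t D d \<Xi> \<mu> \<sigma> =
     (INF (\<nu>, l0, l1, l2, l3) \<in> silp_feasible V L s t D d \<Xi> \<mu> \<sigma>. ereal l3)"


section \<open>Finite-dimensional conic reformulation\<close>

definition perspective_cone ::
  "('a::euclidean_space \<times> 'b::euclidean_space) set \<Rightarrow> ('a \<times> 'b \<times> real) set" where
  "perspective_cone S = closure {(x, u, w). (x /\<^sub>R w, u /\<^sub>R w) \<in> S \<and> w > 0}"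

text \<open>The set \<open>F\<close> of tuples \<open>(\<nu>, \<dots>)\<close> is cut out by \<open>\<nu> \<in> V\<close> and by a finite system, in the tuple
  and finitely many auxiliary real variables \<open>v\<close>, of affine equations (\<open>e\<close>), affine inequalities
  (\<open>h\<close>) and memberships of affine expressions (\<open>a\<close>, \<open>b\<close>, \<open>c\<close>) in the given cones.\<close>

definition conic_reformulation ::
  "'v::euclidean_space set \<Rightarrow> ('v \<times> 'w::euclidean_space) set \<Rightarrow>
   'a::euclidean_space set \<Rightarrow> 'b::euclidean_space set \<Rightarrow> 'c::euclidean_space set \<Rightarrow> bool" where
  "conic_reformulation V F K1 K2 K3 \<longleftrightarrow>
     (\<exists>(q::nat) (Ne::nat) (Nh::nat) (N1::nat) (N2::nat) (N3::nat)
        (e :: nat \<Rightarrow> 'v \<times> 'w \<Rightarrow> (nat \<Rightarrow> real) \<Rightarrow> real)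
        (h :: nat \<Rightarrow> 'v \<times> 'w \<Rightarrow> (nat \<Rightarrow> real) \<Rightarrow> real)
        (a :: nat \<Rightarrow> 'v \<times> 'w \<Rightarrow> (nat \<Rightarrow> real) \<Rightarrow> 'a)
        (b :: nat \<Rightarrow> 'v \<times> 'w \<Rightarrow> (nat \<Rightarrow> real) \<Rightarrow> 'b)
        (c :: nat \<Rightarrow> 'v \<times> 'w \<Rightarrow> (nat \<Rightarrow> real) \<Rightarrow> 'c).
        (\<forall>i<Ne. affine_aux q (e i)) \<and> (\<forall>i<Nh. affine_aux q (h i)) \<and>
        (\<forall>i<N1. affine_aux q (a i)) \<and> (\<forall>i<N2. affine_aux q (b i)) \<and>
        (\<forall>i<N3. affine_aux q (c i)) \<and>
        F = {\<xi>. fst \<xi> \<in> V \<and>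
              (\<exists>v. (\<forall>i<Ne. e i \<xi> v = 0) \<and> (\<forall>i<Nh. h i \<xi> v \<le> 0) \<and>
                   (\<forall>i<N1. a i \<xi> v \<in> K1) \<and> (\<forall>i<N2. b i \<xi> v \<in> K2) \<and>
                   (\<forall>i<N3. c i \<xi> v \<in> K3))})"

end

theory Submission
  imports Defs
begin

text \<open>
Fix a decision \<open>\<nu>\<close>. Conditioning enters only through a ratio: since every distribution in the
ambiguity set charges \<open>\<Xi>\<close>, the conditional expectation of \<open>f \<nu>\<close> is at most \<open>l3\<close> exactly if the
unconditional expectation of \<open>G = (f \<nu> - l3) 1_\<Xi>\<close> is at most \<open>0\<close>. The worst-case conditional
expectation is therefore the least \<open>l3\<close> for which a classical generalized moment problem, with
constraints on the means of \<open>x\<close> and \<open>d x\<close>, has nonpositive value.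

By duality this value is nonpositive iff \<open>G\<close> has a majorant \<open>l0 + l1 \<bullet> x + l2 \<bullet> d x\<close>, with \<open>l2\<close> in
the dual cone, that is nonpositive at the pair of moments \<open>(\<mu>, \<sigma>)\<close>. That a majorant suffices
follows by integrating it (\<open>moment_weak_duality\<close>). That one exists is a separation argument
(\<open>moment_strong_duality\<close>): every point of the convex hull of the epigraph-like set of all
\<open>(x, u, g)\<close> with \<open>d x \<preceq> u\<close> and \<open>g \<le> G x\<close> consists of moments of a finitely supported
distribution, so this hull misses the ray above \<open>(\<mu>, \<sigma>, 0)\<close>; the coefficients of a separating
hyperplane are the multipliers, and the Slater condition forces the hyperplane to be nonvertical.

On \<open>\<Xi>\<close> and off \<open>\<Xi>\<close> the majorization of \<open>G\<close> becomes the two families of constraints of the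
semi-infinite program (\<open>silp_feasible_iff_majorant\<close>). The variable \<open>u\<close> may replace \<open>d x\<close> because
\<open>l2\<close> is nonnegative on the cone, and the passage from the complement of \<open>\<Xi>\<close> to its closure
requires \<open>d\<close> to be continuous. Continuity, and with it the measurability of \<open>d\<close>, holds because
each \<open>a \<bullet> d x\<close> with \<open>a\<close> in the dual cone is a finite convex function, and the dual of a pointed
closed convex cone spans the space.

The conic reformulation is a rewriting of the constraints: an affine function of \<open>(x, u)\<close> is
nonnegative on a set iff its coefficient vector lies in the dual of the perspective cone of the
set (\<open>dual_perspective_cone_iff\<close>). With finitely many pieces this is a finite system.
\<close>

section \<open>Cone duality and regularity of cone-convex maps\<close>

text \<open>The form in which the Slater condition is used: a dual vector that is not positive at an interior
  point \<open>z\<close> vanishes, as \<open>z\<close> can be moved slightly in the direction \<open>- a\<close>.\<close>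

lemma dual_cone_interior_zero:
  fixes D :: "'b::euclidean_space set"
  assumes a: "a \<in> dual_cone D" and z: "z \<in> interior D" and le: "a \<bullet> z \<le> 0"
  shows "a = 0"
proof -
  obtain e where e: "e > 0" "cball z e \<subseteq> D"
    using z by (auto simp: mem_interior_cball)
  \<comment> \<open>Adding \<open>1\<close> in the denominator avoids a division by zero in the case \<open>a = 0\<close>.\<close>
  define k where "k = e / (norm a + 1)"
  have k: "k > 0" using e by (simp add: k_def add_nonneg_pos)
  have "k * norm a \<le> e"
    using e mult_left_mono[of "norm a" "norm a + 1" e]
    by (simp add: k_def pos_divide_le_eq add_nonneg_pos)
  then have "z - k *\<^sub>R a \<in> cball z e"
    using k by (simp add: dist_norm)
  then have "0 \<le> a \<bullet> (z - k *\<^sub>R a)"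
    using a e(2) unfolding dual_cone_def by blast
  then have "k * (a \<bullet> a) \<le> 0" using le by (simp add: inner_diff_right)
  then show ?thesis using k
    by (metis antisym_conv inner_eq_zero_iff inner_ge_zero mult_le_0_iff not_less)
qed

text \<open>The bidual cone theorem: a hyperplane that strictly separates \<open>c\<close> from the cone can be moved to
  the origin, since a linear function that is bounded below on a cone is nonnegative there.\<close>

lemma in_cone_if_nonneg_on_dual:
  fixes D :: "'b::euclidean_space set"
  assumes D: "closed D" "convex D" "cone D" "D \<noteq> {}"
    and c: "\<And>v. v \<in> dual_cone D \<Longrightarrow> 0 \<le> v \<bullet> c"
  shows "c \<in> D"
proof (rule ccontr)
  assume "c \<notin> D"
  then obtain a b where ab: "a \<bullet> c < b" "\<And>x. x \<in> D \<Longrightarrow> b < a \<bullet> x"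
    using separating_hyperplane_closed_point[OF D(2,1)] by blast
  have b0: "b < 0" using ab(2)[of 0] D(3,4) cone_contains_0 by fastforce
  have "0 \<le> a \<bullet> x" if x: "x \<in> D" for x
  proof (rule ccontr)
    assume "\<not> 0 \<le> a \<bullet> x"
    then have neg: "a \<bullet> x < 0" by simp
    \<comment> \<open>This multiple of \<open>x\<close> lies on the hyperplane itself.\<close>
    have "(b / (a \<bullet> x)) *\<^sub>R x \<in> D"
      using D(3) x b0 neg by (simp add: cone_def divide_nonpos_neg)
    then show False using ab(2) neg by fastforce
  qed
  then have "a \<in> dual_cone D" by (simp add: dual_cone_def)
  then show False using c ab(1) b0 by fastforce
qed

text \<open>A vector orthogonal to the dual cone would span a line inside the bidual, that is, inside
  the cone, which pointedness excludes.\<close>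

lemma span_dual_cone:
  fixes D :: "'b::euclidean_space set"
  assumes D: "proper_cone D"
  shows "span (dual_cone D) = UNIV"
proof (rule ccontr)
  assume "span (dual_cone D) \<noteq> UNIV"
  then obtain c where c: "c \<noteq> 0" "\<And>v. v \<in> span (dual_cone D) \<Longrightarrow> c \<bullet> v = 0"
    using span_not_univ_subset_hyperplane by blast
  have ne: "D \<noteq> {}" using D interior_subset by (fastforce simp: proper_cone_def)
  have "v \<bullet> c = 0" if "v \<in> dual_cone D" for v
    using c(2)[OF span_base[OF that]] by (simp add: inner_commute)
  then have "c \<in> D" "- c \<in> D"
    using in_cone_if_nonneg_on_dual[of D] D ne by (auto simp: proper_cone_def)
  then show False using D c(1) by (auto simp: proper_cone_def pointed_def)
qed

lemma convex_on_inner_cone_convex: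
  fixes d :: "'a::real_vector \<Rightarrow> 'b::euclidean_space"
  assumes d: "cone_convex D d" and a: "a \<in> dual_cone D"
  shows "convex_on UNIV (\<lambda>x. a \<bullet> d x)"
proof (rule convex_onI)
  fix t x y assume t: "0 < (t::real)" "t < 1"
  have "cone_le D (d ((1 - t) *\<^sub>R x + (1 - (1 - t)) *\<^sub>R y)) ((1 - t) *\<^sub>R d x + (1 - (1 - t)) *\<^sub>R d y)"
    using d t unfolding cone_convex_def by (meson atLeastAtMost_iff diff_ge_0_iff_ge diff_le_eq le_add_same_cancel1 less_imp_le)
  then have "0 \<le> a \<bullet> ((1 - t) *\<^sub>R d x + t *\<^sub>R d y - d ((1 - t) *\<^sub>R x + t *\<^sub>R y))"
    using a by (simp add: cone_le_def dual_cone_def)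
  then show "a \<bullet> d ((1 - t) *\<^sub>R x + t *\<^sub>R y) \<le> (1 - t) * (a \<bullet> d x) + t * (a \<bullet> d y)"
    by (simp add: inner_diff_right inner_add_right)
qed simp

text \<open>Every coordinate of \<open>d\<close> is a linear combination of functions \<open>a \<bullet> d x\<close> with \<open>a\<close> in the dual
  cone; these are real-valued and convex, hence continuous.\<close>

lemma continuous_on_cone_convex:
  fixes d :: "'a::euclidean_space \<Rightarrow> 'b::euclidean_space"
  assumes D: "proper_cone D" and d: "cone_convex D d"
  shows "continuous_on UNIV d"
proof (rule continuous_on_componentwise[THEN iffD2], rule ballI)
  fix i :: 'b assume "i \<in> Basis"
  have "i \<in> span (dual_cone D)" by (simp add: span_dual_cone[OF D])
  then have "continuous_on UNIV (\<lambda>x. i \<bullet> d x)"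
  proof (induction rule: span_induct_alt)
    case base
    then show ?case by simp
  next
    case (step c a y)
    have "continuous_on UNIV (\<lambda>x. a \<bullet> d x)"
      by (rule convex_on_continuous[OF open_UNIV convex_on_inner_cone_convex[OF d step(1)]])
    then have "continuous_on UNIV (\<lambda>x. c * (a \<bullet> d x) + y \<bullet> d x)"
      using step(2) by (intro continuous_on_add continuous_on_mult_left)
    then show ?case by (simp add: inner_add_left)
  qed
  then show "continuous_on UNIV (\<lambda>x. d x \<bullet> i)" by (simp add: inner_commute)
qed

section \<open>Moments of finitely supported distributions\<close>

text \<open>The coefficients of a convex combination are the weights of a distribution. The slack in
  \<open>d x \<preceq> u\<close> and \<open>g \<le> G x\<close> is averaged along and stays in the cone, respectively nonnegative, so
  the combination meets the moment constraints and its last coordinate bounds the mean of \<open>G\<close> from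
  below.\<close>

lemma finitely_supported_moments:
  fixes d :: "'a::euclidean_space \<Rightarrow> 'b::euclidean_space" and G :: "'a \<Rightarrow> real"
  assumes D: "proper_cone D" and d: "d \<in> borel_measurable borel" and G: "G \<in> borel_measurable borel"
    and hull: "(\<mu>, \<sigma>, \<gamma>) \<in> convex hull {(x, u, g). cone_le D (d x) u \<and> g \<le> G x}"
  shows "\<exists>P \<in> mean_dispersion_set D d \<mu> \<sigma>. integrable P G \<and> \<gamma> \<le> integral\<^sup>L P G"
proof -
  let ?S = "{(x, u, g). cone_le D (d x) u \<and> g \<le> G x}"
  obtain T c where T: "finite T" "T \<subseteq> ?S" and c: "\<And>v. v \<in> T \<Longrightarrow> 0 \<le> c v" "sum c T = 1"
    and eq: "(\<Sum>v\<in>T. c v *\<^sub>R v) = (\<mu>, \<sigma>, \<gamma>)"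
    using hull unfolding convex_hull_explicit by auto
  \<comment> \<open>Weights sit on the points of \<open>T\<close>, which may share their first coordinate; the image measure
    merges such atoms.\<close>
  define Q where "Q = point_measure T (\<lambda>v. ennreal (c v))"
  define P where "P = distr Q borel (fst :: 'a \<times> 'b \<times> real \<Rightarrow> 'a)"
  have setsQ: "sets Q = Pow T" and spQ: "space Q = T"
    by (auto simp: Q_def sets_point_measure space_point_measure)
  have m: "fst \<in> measurable Q (borel :: 'a measure)"
    by (auto simp: Q_def)
  have "emeasure Q (space Q) = ennreal (sum c T)"
    using T(1) c(1) by (simp add: Q_def space_point_measure emeasure_point_measure_finite)
  then have "prob_space Q" using c(2) by (intro prob_spaceI) simp
  then have ps: "prob_space P"
    unfolding P_def by (rule prob_space.prob_space_distr[OF _ m])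
  have int: "integrable P h" "integral\<^sup>L P h = (\<Sum>v\<in>T. c v *\<^sub>R h (fst v))"
    if h: "h \<in> borel_measurable borel" for h :: "'a \<Rightarrow> 'c::euclidean_space"
  proof -
    have "integrable Q (\<lambda>v. h (fst v))"
      unfolding Q_def using T(1) c(1) by (intro integrable_point_measure_finite)
    then show "integrable P h"
      unfolding P_def by (simp add: integrable_distr_eq[OF m h])
    show "integral\<^sup>L P h = (\<Sum>v\<in>T. c v *\<^sub>R h (fst v))"
      unfolding P_def integral_distr[OF m h] unfolding Q_def
      using T(1) c(1) by (intro lebesgue_integral_point_measure_finite) auto
  qed
  have "(\<Sum>v\<in>T. c v *\<^sub>R fst v) = \<mu>"
    using arg_cong[OF eq, of fst] by (simp add: fst_sum)
  then have mean: "integral\<^sup>L P (\<lambda>x. x) = \<mu>" using int(2)[of "\<lambda>x. x"] by simp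
  have sig: "(\<Sum>v\<in>T. c v *\<^sub>R fst (snd v)) = \<sigma>" and gam: "(\<Sum>v\<in>T. c v * snd (snd v)) = \<gamma>"
    using arg_cong[OF eq, of "\<lambda>z. fst (snd z)"] arg_cong[OF eq, of "\<lambda>z. snd (snd z)"]
    by (simp_all add: fst_sum snd_sum)
  have "\<sigma> - integral\<^sup>L P d = (\<Sum>v\<in>T. c v *\<^sub>R (fst (snd v) - d (fst v)))"
    unfolding int(2)[OF d] sig[symmetric] by (simp add: sum_subtractf scaleR_diff_right)
  also have "\<dots> \<in> D"
    using D T c by (intro convex_sum) (auto simp: proper_cone_def cone_le_def)
  finally have disp: "cone_le D (integral\<^sup>L P d) \<sigma>" by (simp add: cone_le_def)
  have "(\<Sum>v\<in>T. c v * snd (snd v)) \<le> (\<Sum>v\<in>T. c v * G (fst v))"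
    using T(2) c(1) by (intro sum_mono mult_left_mono) auto
  then have "\<gamma> \<le> integral\<^sup>L P G" using int(2)[OF G] gam by simp
  moreover have "P \<in> mean_dispersion_set D d \<mu> \<sigma>"
    using ps mean disp int(1)[of "\<lambda>x. x"] int(1)[OF d]
    by (simp add: mean_dispersion_set_def borel_probs_def P_def)
  ultimately show ?thesis using int(1)[OF G] by blast
qed

section \<open>Strong duality for the moment problem\<close>

lemma slope_nonpos_if_bounded_above:
  fixes \<alpha> \<beta> b :: real
  assumes "\<And>k. 0 \<le> k \<Longrightarrow> \<alpha> + k * \<beta> \<le> b"
  shows "\<beta> \<le> 0"
proof (rule ccontr)
  assume "\<not> \<beta> \<le> 0"
  then have "\<alpha> + (\<bar>b - \<alpha>\<bar> + 1) \<le> b" using assms[of "(\<bar>b - \<alpha>\<bar> + 1) / \<beta>"] by simp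
  then show False by linarith
qed

text \<open>The finitely supported distributions already force the existence of multipliers. Enlarging the
  graph of \<open>(d, G)\<close> by the cone and by smaller values of \<open>g\<close> gives the separating hyperplane the
  correct signs. If it were vertical (\<open>a3 = 0\<close>), then the Slater condition at \<open>\<mu>\<close> gives
  \<open>a2 = 0\<close>, and a linear function bounded above on the whole space gives \<open>a1 = 0\<close>.\<close>

lemma moment_strong_duality:
  fixes d :: "'a::euclidean_space \<Rightarrow> 'b::euclidean_space" and G :: "'a \<Rightarrow> real"
  assumes D: "proper_cone D" and d: "d \<in> borel_measurable borel" and G: "G \<in> borel_measurable borel"
    and slater: "cone_less D (d \<mu>) \<sigma>"
    and le: "\<And>P. P \<in> mean_dispersion_set D d \<mu> \<sigma> \<Longrightarrow> integrable P G \<Longrightarrow> integral\<^sup>L P G \<le> 0"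
  shows "\<exists>l0 l1 l2. l2 \<in> dual_cone D \<and> l0 + l1 \<bullet> \<mu> + l2 \<bullet> \<sigma> \<le> 0 \<and>
           (\<forall>x. G x \<le> l0 + l1 \<bullet> x + l2 \<bullet> d x)"
proof -
  let ?S = "{(x, u, g). cone_le D (d x) u \<and> g \<le> G x}"
  let ?M = "convex hull ?S"
  let ?T = "{\<mu>} \<times> {\<sigma>} \<times> {0::real<..}"
  have ne: "D \<noteq> {}" using D interior_subset by (fastforce simp: proper_cone_def)
  then have D0: "0 \<in> D" using D cone_contains_0 by (auto simp: proper_cone_def)
  have D_scale: "k *\<^sub>R w \<in> D" if "0 \<le> k" "w \<in> D" for k w
    using D that by (simp add: proper_cone_def cone_def)
  have inS: "(x, d x + w, g) \<in> ?S" if "w \<in> D" "g \<le> G x" for x w g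
    using that by (simp add: cone_le_def)
  have "(\<mu>, d \<mu> + 0, G \<mu>) \<in> ?M" by (rule hull_inc[OF inS[OF D0 order_refl]])
  then have M_ne: "?M \<noteq> {}" by blast
  have disjoint: "?M \<inter> ?T = {}"
  proof (rule equals0I)
    fix z assume "z \<in> ?M \<inter> ?T"
    then obtain g where "(\<mu>, \<sigma>, g) \<in> ?M" "0 < g" by (cases z) auto
    then obtain P where "P \<in> mean_dispersion_set D d \<mu> \<sigma>" "integrable P G" "0 < integral\<^sup>L P G"
      using finitely_supported_moments[OF D d G] by (meson less_le_trans)
    then show False using le[of P] by linarith
  qed
  have T_convex: "convex ?T" by (intro convex_Times convex_singleton) (rule convex_real_interval)
  have "(\<mu>, \<sigma>, 1) \<in> ?T" by simp
  then have T_ne: "?T \<noteq> {}" by blast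
  obtain a b where a: "a \<noteq> 0" and "\<forall>z\<in>?M. a \<bullet> z \<le> b" "\<forall>z\<in>?T. b \<le> a \<bullet> z"
    using separating_hyperplane_sets[OF convex_convex_hull T_convex M_ne T_ne disjoint] by auto
  then have upper: "\<And>z. z \<in> ?M \<Longrightarrow> a \<bullet> z \<le> b" and lower: "\<And>z. z \<in> ?T \<Longrightarrow> b \<le> a \<bullet> z"
    by fast+
  obtain a1 a2 a3 where a_eq: "a = (a1, a2, a3)" by (cases a)
  have up: "a1 \<bullet> x + a2 \<bullet> (d x + w) + a3 * g \<le> b" if "w \<in> D" "g \<le> G x" for x w g
    using upper[OF hull_inc[OF inS[OF that]]] by (simp add: a_eq)
  have low: "b \<le> a1 \<bullet> \<mu> + a2 \<bullet> \<sigma> + a3 * g" if "g > 0" for g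
    using lower[of "(\<mu>, \<sigma>, g)"] that by (simp add: a_eq)
  have "- a3 \<le> 0"
  proof (rule slope_nonpos_if_bounded_above)
    fix k :: real assume "0 \<le> k"
    then show "a1 \<bullet> \<mu> + a2 \<bullet> d \<mu> + a3 * G \<mu> + k * - a3 \<le> b"
      using up[OF D0, of "G \<mu> - k" \<mu>] by (simp add: algebra_simps)
  qed
  then have a3: "0 \<le> a3" by simp
  have b: "b \<le> a1 \<bullet> \<mu> + a2 \<bullet> \<sigma>"
  proof (rule field_le_epsilon)
    fix e :: real assume "0 < e"
    then show "b \<le> a1 \<bullet> \<mu> + a2 \<bullet> \<sigma> + e"
      using a3 low[of "e / a3"] low[of 1] by (cases "a3 = 0") auto
  qed
  have "a2 \<bullet> w \<le> 0" if w: "w \<in> D" for w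
  proof (rule slope_nonpos_if_bounded_above)
    fix k :: real assume "0 \<le> k"
    then show "a1 \<bullet> \<mu> + a2 \<bullet> d \<mu> + a3 * G \<mu> + k * (a2 \<bullet> w) \<le> b"
      using up[OF D_scale[OF _ w], of k "G \<mu>" \<mu>] by (simp add: algebra_simps inner_add_right)
  qed
  then have a2: "- a2 \<in> dual_cone D" by (simp add: dual_cone_def)
  have "a3 \<noteq> 0"
  proof
    assume z: "a3 = 0"
    have "- a2 \<bullet> (\<sigma> - d \<mu>) \<le> 0"
      using up[OF D0 order_refl, of \<mu>] b z by (simp add: inner_diff_right)
    then have "- a2 = 0"
      using slater dual_cone_interior_zero[OF a2] by (simp add: cone_less_def)
    then have a20: "a2 = 0" by simp
    \<comment> \<open>Testing the remaining inequality \<open>a1 \<bullet> x \<le> a1 \<bullet> \<mu>\<close> one step in the direction \<open>a1\<close>.\<close>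
    have "a1 \<bullet> a1 \<le> 0"
      using up[OF D0 order_refl, of "\<mu> + a1"] b z a20 by (simp add: inner_add_right)
    then have "a1 = 0" by (simp only: inner_ge_zero antisym_conv inner_eq_zero_iff)
    then show False using a a_eq z a20 by (simp add: zero_prod_def)
  qed
  then have a3p: "0 < a3" using a3 by simp
  \<comment> \<open>Solving the hyperplane inequality for \<open>g\<close>; \<open>l0\<close> makes the majorant vanish at \<open>(\<mu>, \<sigma>)\<close>.\<close>
  define l1 where "l1 = - (a1 /\<^sub>R a3)"
  define l2 where "l2 = (- a2) /\<^sub>R a3"
  define l0 where "l0 = - (l1 \<bullet> \<mu>) - l2 \<bullet> \<sigma>"
  have "l2 \<in> dual_cone D"
    using a2 a3p by (auto simp: dual_cone_def l2_def mult_nonneg_nonpos divide_nonpos_pos)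
  moreover have "G x \<le> l0 + l1 \<bullet> x + l2 \<bullet> d x" for x
  proof -
    have "a1 \<bullet> x + a2 \<bullet> d x + a3 * G x \<le> a1 \<bullet> \<mu> + a2 \<bullet> \<sigma>"
      using up[OF D0 order_refl, of x] b by simp
    moreover have "a3 * (l1 \<bullet> y) = - (a1 \<bullet> y)" for y
      using a3p by (simp add: l1_def)
    moreover have "a3 * (l2 \<bullet> y) = - (a2 \<bullet> y)" for y
      using a3p by (simp add: l2_def)
    ultimately have "a3 * G x \<le> a3 * (l0 + l1 \<bullet> x + l2 \<bullet> d x)"
      by (simp add: l0_def distrib_left right_diff_distrib)
    then show ?thesis using a3p by simp
  qed
  ultimately show ?thesis by (intro exI[of _ l0] exI[of _ l1] exI[of _ l2]) (simp add: l0_def)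
qed

section \<open>Semi-infinite constraints as a pointwise majorization\<close>

text \<open>A halfspace that contains the graph of \<open>d\<close> over the complement of \<open>\<Xi>\<close> also contains the graph over
  the closure, by continuity, and the convex hull of that, by convexity.\<close>

lemma Cbar_constraint_iff:
  fixes d :: "'a::euclidean_space \<Rightarrow> 'b::euclidean_space"
  assumes d: "continuous_on UNIV d"
  shows "(\<forall>(x, u) \<in> Cbar_set d \<Xi>. l0 + l1 \<bullet> x + l2 \<bullet> u \<ge> 0) \<longleftrightarrow>
         (\<forall>x. x \<notin> \<Xi> \<longrightarrow> 0 \<le> l0 + l1 \<bullet> x + l2 \<bullet> d x)" (is "?L \<longleftrightarrow> ?R")
proof
  assume L: ?L
  show ?R
  proof (intro allI impI)
    fix x assume "x \<notin> \<Xi>"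
    then have "x \<in> closure (UNIV - \<Xi>)" by (meson DiffI UNIV_I closure_subset subsetD)
    then have "(x, d x) \<in> Cbar_set d \<Xi>"
      unfolding Cbar_set_def by (intro hull_inc) simp
    then show "0 \<le> l0 + l1 \<bullet> x + l2 \<bullet> d x" using L by auto
  qed
next
  assume R: ?R
  let ?H = "{z. (l1, l2) \<bullet> z \<ge> - l0}"
  have "closed {x. 0 \<le> l0 + l1 \<bullet> x + l2 \<bullet> d x}"
    by (intro closed_Collect_le continuous_intros d)
  then have "closure (UNIV - \<Xi>) \<subseteq> {x. 0 \<le> l0 + l1 \<bullet> x + l2 \<bullet> d x}"
    using R by (intro closure_minimal) auto
  then have "{(x, u). x \<in> closure (UNIV - \<Xi>) \<and> d x = u} \<subseteq> ?H"
    by fastforce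
  then have "Cbar_set d \<Xi> \<subseteq> ?H"
    unfolding Cbar_set_def by (intro hull_minimal convex_halfspace_ge)
  then show ?L by fastforce
qed

text \<open>Among all \<open>u\<close> with \<open>d x \<preceq> u\<close>, the choice \<open>u = d x\<close> is the most restrictive one, since \<open>l2\<close> is
  nonnegative on the cone.\<close>

lemma C_constraint_iff:
  fixes d :: "'a::euclidean_space \<Rightarrow> 'b::euclidean_space"
  assumes l2: "l2 \<in> dual_cone D" and D: "0 \<in> D"
  shows "(\<forall>(x, u) \<in> C_set D d \<Xi>. \<forall>l\<in>L. l0 + l1 \<bullet> x + l2 \<bullet> u + l3 \<ge> s l \<nu> \<bullet> x + t l \<nu>) \<longleftrightarrow>
         (\<forall>x\<in>\<Xi>. \<forall>l\<in>L. s l \<nu> \<bullet> x + t l \<nu> \<le> l0 + l1 \<bullet> x + l2 \<bullet> d x + l3)" (is "?L \<longleftrightarrow> ?R")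
proof
  assume L: ?L
  show ?R using L D by (fastforce simp: C_set_def cone_le_def)
next
  assume R: ?R
  have "l2 \<bullet> d x \<le> l2 \<bullet> u" if "cone_le D (d x) u" for x u
    using that l2 by (auto simp: cone_le_def dual_cone_def inner_diff_right)
  then show ?L using R by (fastforce simp: C_set_def)
qed

text \<open>For fixed \<open>\<nu>\<close> and \<open>l3\<close>, feasibility says that \<open>(l0, l1, l2)\<close> is dual feasible for the moment problem
  with objective \<open>(F - l3) 1_\<Xi>\<close>: the constraints over \<open>C\<close> are the majorization on \<open>\<Xi>\<close>, those over
  \<open>Cbar\<close> the majorization where the objective is zero.\<close>

lemma silp_feasible_iff_majorant:
  fixes d :: "'a::euclidean_space \<Rightarrow> 'b::euclidean_space"
  assumes d: "continuous_on UNIV d" and D: "0 \<in> D" and \<nu>: "\<nu> \<in> V"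
    and F: "\<And>x. (\<exists>l\<in>L. F x = s l \<nu> \<bullet> x + t l \<nu>) \<and> (\<forall>l\<in>L. s l \<nu> \<bullet> x + t l \<nu> \<le> F x)"
  shows "(\<nu>, l0, l1, l2, l3) \<in> silp_feasible V L s t D d \<Xi> \<mu> \<sigma> \<longleftrightarrow>
    l2 \<in> dual_cone D \<and> l0 + l1 \<bullet> \<mu> + l2 \<bullet> \<sigma> \<le> 0 \<and>
    (\<forall>x. (F x - l3) * indicator \<Xi> x \<le> l0 + l1 \<bullet> x + l2 \<bullet> d x)"
proof (cases "l2 \<in> dual_cone D")
  case True
  have "(\<forall>l\<in>L. s l \<nu> \<bullet> x + t l \<nu> \<le> c) \<longleftrightarrow> F x \<le> c" for x c
    using F[of x] by force
  then have "(\<forall>(x, u) \<in> C_set D d \<Xi>. \<forall>l\<in>L. l0 + l1 \<bullet> x + l2 \<bullet> u + l3 \<ge> s l \<nu> \<bullet> x + t l \<nu>) \<longleftrightarrow>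
         (\<forall>x\<in>\<Xi>. F x - l3 \<le> l0 + l1 \<bullet> x + l2 \<bullet> d x)"
    unfolding C_constraint_iff[OF True D] by (simp add: diff_le_eq)
  then show ?thesis
    using True \<nu> unfolding silp_feasible_def
    by (auto simp: Cbar_constraint_iff[OF d] indicator_def)
qed (simp add: silp_feasible_def)

section \<open>Equality of the optimal values\<close>

lemma ext_expectation_integrable:
  fixes H :: "'a \<Rightarrow> real"
  assumes "integrable P H"
  shows "ext_expectation P H = ereal (integral\<^sup>L P H)"
proof -
  have "(\<integral>\<^sup>+x. ennreal (H x) \<partial>P) < \<infinity>" "(\<integral>\<^sup>+x. ennreal (- H x) \<partial>P) < \<infinity>"
    using assms by (auto simp: real_integrable_def top.not_eq_extremum)
  then show ?thesis
    unfolding ext_expectation_def real_lebesgue_integral_def[OF assms]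
    by (cases "\<integral>\<^sup>+x. ennreal (H x) \<partial>P"; cases "\<integral>\<^sup>+x. ennreal (- H x) \<partial>P") (auto simp: enn2ereal_ennreal)
qed

lemma cond_expectation_le_iff:
  assumes "integrable P (\<lambda>x. F x * indicator \<Xi> x)" "0 < measure P \<Xi>"
  shows "cond_expectation P F \<Xi> \<le> ereal c \<longleftrightarrow>
    integral\<^sup>L P (\<lambda>x. F x * indicator \<Xi> x) \<le> c * measure P \<Xi>"
  using assms by (simp add: cond_expectation_def ext_expectation_integrable field_simps)

text \<open>The affine minorant of \<open>F\<close> and the majorant of \<open>(F - l3) 1_\<Xi>\<close> are both integrable under the moment
  conditions, so \<open>F\<close> is integrable over \<open>\<Xi>\<close> and the majorization can be integrated.\<close>

lemma moment_weak_duality: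
  fixes d :: "'a::euclidean_space \<Rightarrow> 'b::euclidean_space"
  assumes P: "P \<in> mean_dispersion_set D d \<mu> \<sigma>" and pos: "0 < measure P \<Xi>"
    and Xi: "\<Xi> \<in> sets borel" and F: "F \<in> borel_measurable borel"
    and minorant: "\<And>x. p \<bullet> x + r \<le> F x"
    and l2: "l2 \<in> dual_cone D" and l: "l0 + l1 \<bullet> \<mu> + l2 \<bullet> \<sigma> \<le> 0"
    and majorant: "\<And>x. (F x - l3) * indicator \<Xi> x \<le> l0 + l1 \<bullet> x + l2 \<bullet> d x"
  shows "cond_expectation P F \<Xi> \<le> ereal l3"
proof -
  from P interpret prob_space P by (simp add: mean_dispersion_set_def borel_probs_def)
  have sets[measurable_cong]: "sets P = sets borel"
    and ix: "integrable P (\<lambda>x. x)" and mean: "integral\<^sup>L P (\<lambda>x. x) = \<mu>"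
    and id: "integrable P d" and disp: "cone_le D (integral\<^sup>L P d) \<sigma>"
    using P by (simp_all add: mean_dispersion_set_def borel_probs_def)
  note [measurable] = Xi F
  have i1: "integrable P (indicator \<Xi> :: 'a \<Rightarrow> real)" by (simp add: emeasure_eq_measure)
  let ?U = "\<lambda>x. l0 + l1 \<bullet> x + l2 \<bullet> d x"
  have iU: "integrable P ?U" using ix id by simp
  have ilow: "integrable P (\<lambda>x. (p \<bullet> x + r - l3) * indicator \<Xi> x)"
    using ix by (intro integrable_real_mult_indicator) (auto simp: sets)
  let ?G = "\<lambda>x. (F x - l3) * indicator \<Xi> x"
  have iG: "integrable P ?G"
  proof (rule Bochner_Integration.integrable_bound)
    show "integrable P (\<lambda>x. \<bar>?U x\<bar> + \<bar>(p \<bullet> x + r - l3) * indicator \<Xi> x\<bar>)"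
      using iU ilow by simp
    have "(p \<bullet> x + r - l3) * indicator \<Xi> x \<le> ?G x" for x
      using minorant[of x] by (intro mult_right_mono) auto
    then have "norm (?G x) \<le> norm (\<bar>?U x\<bar> + \<bar>(p \<bullet> x + r - l3) * indicator \<Xi> x\<bar>)" for x
      using majorant[of x] by (smt (verit) real_norm_def)
    then show "AE x in P. norm (?G x) \<le> norm (\<bar>?U x\<bar> + \<bar>(p \<bullet> x + r - l3) * indicator \<Xi> x\<bar>)"
      by simp
  qed measurable
  have "integrable P (\<lambda>x. ?G x + l3 * indicator \<Xi> x)" using iG i1 by simp
  then have iH: "integrable P (\<lambda>x. F x * indicator \<Xi> x)" by (simp add: algebra_simps)
  have "integral\<^sup>L P (\<lambda>x. F x * indicator \<Xi> x) - l3 * measure P \<Xi> = integral\<^sup>L P ?G"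
    using iH i1 by (simp add: left_diff_distrib sets)
  also have "\<dots> \<le> integral\<^sup>L P ?U"
    by (rule integral_mono[OF iG iU majorant])
  also have "\<dots> = l0 + l1 \<bullet> \<mu> + l2 \<bullet> integral\<^sup>L P d"
    using ix id mean by (simp add: prob_space)
  also have "\<dots> \<le> l0 + l1 \<bullet> \<mu> + l2 \<bullet> \<sigma>"
    using l2 disp by (auto simp: cone_le_def dual_cone_def inner_diff_right)
  finally show ?thesis using l by (simp add: cond_expectation_le_iff[OF iH pos])
qed

text \<open>Multiplying the bound on the conditional expectation by the probability of \<open>\<Xi>\<close> turns it into
  the hypothesis of \<open>moment_strong_duality\<close> for \<open>(F - l3) 1_\<Xi>\<close>.\<close>

lemma conditional_strong_duality:
  fixes d :: "'a::euclidean_space \<Rightarrow> 'b::euclidean_space"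
  assumes D: "proper_cone D" and d: "d \<in> borel_measurable borel" and slater: "cone_less D (d \<mu>) \<sigma>"
    and Xi: "\<Xi> \<in> sets borel" and F: "F \<in> borel_measurable borel"
    and pos: "\<And>P. P \<in> mean_dispersion_set D d \<mu> \<sigma> \<Longrightarrow> 0 < measure P \<Xi>"
    and le: "\<And>P. P \<in> mean_dispersion_set D d \<mu> \<sigma> \<Longrightarrow> cond_expectation P F \<Xi> \<le> ereal l3"
  shows "\<exists>l0 l1 l2. l2 \<in> dual_cone D \<and> l0 + l1 \<bullet> \<mu> + l2 \<bullet> \<sigma> \<le> 0 \<and>
           (\<forall>x. (F x - l3) * indicator \<Xi> x \<le> l0 + l1 \<bullet> x + l2 \<bullet> d x)"
proof (rule moment_strong_duality[OF D d _ slater])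
  show "(\<lambda>x. (F x - l3) * indicator \<Xi> x) \<in> borel_measurable borel"
    using Xi F by measurable
next
  fix P assume P: "P \<in> mean_dispersion_set D d \<mu> \<sigma>"
    and iG: "integrable P (\<lambda>x. (F x - l3) * indicator \<Xi> x)"
  from P interpret prob_space P by (simp add: mean_dispersion_set_def borel_probs_def)
  have sets: "sets P = sets borel"
    using P by (simp add: mean_dispersion_set_def borel_probs_def)
  have i1: "integrable P (indicator \<Xi> :: 'a \<Rightarrow> real)"
    using Xi by (simp add: emeasure_eq_measure sets)
  have "integrable P (\<lambda>x. (F x - l3) * indicator \<Xi> x + l3 * indicator \<Xi> x)" using iG i1 by simp
  then have iH: "integrable P (\<lambda>x. F x * indicator \<Xi> x)" by (simp add: algebra_simps)
  have "integral\<^sup>L P (\<lambda>x. F x * indicator \<Xi> x) \<le> l3 * measure P \<Xi>"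
    using le[OF P] cond_expectation_le_iff[OF iH pos[OF P]] by simp
  then show "integral\<^sup>L P (\<lambda>x. (F x - l3) * indicator \<Xi> x) \<le> 0"
    using iH i1 Xi by (simp add: left_diff_distrib sets)
qed

text \<open>With infinitely many pieces, continuity does not come from the pieces; a real-valued
  maximum of affine functions is continuous because it is convex.\<close>

lemma continuous_on_max_affine:
  fixes F :: "'a::euclidean_space \<Rightarrow> real"
  assumes F: "\<And>x. (\<exists>l\<in>L. F x = s l \<bullet> x + t l) \<and> (\<forall>l\<in>L. s l \<bullet> x + t l \<le> F x)"
  shows "continuous_on UNIV F"
proof (rule convex_on_continuous[OF open_UNIV], rule convex_onI)
  fix k x y assume k: "0 < (k::real)" "k < 1"
  obtain l where l: "l \<in> L" "F ((1 - k) *\<^sub>R x + k *\<^sub>R y) = s l \<bullet> ((1 - k) *\<^sub>R x + k *\<^sub>R y) + t l"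
    using F by blast
  have "(1 - k) * (s l \<bullet> x + t l) + k * (s l \<bullet> y + t l) \<le> (1 - k) * F x + k * F y"
    using k l F by (intro add_mono mult_left_mono) auto
  then show "F ((1 - k) *\<^sub>R x + k *\<^sub>R y) \<le> (1 - k) * F x + k * F y"
    using l by (simp add: inner_add_right algebra_simps)
qed simp

text \<open>Both inequalities compare, for fixed \<open>\<nu>\<close>, the real upper bounds \<open>l3\<close> of the worst-case conditional
  expectation with the objective values of feasible multipliers: weak duality bounds the worst
  case by every feasible value, and strong duality attains every upper bound.\<close>

lemma cdro_value_eq_silp_value:
  fixes d :: "'a::euclidean_space \<Rightarrow> 'b::euclidean_space"
  assumes D: "proper_cone D" and d: "cone_convex D d" and slater: "cone_less D (d \<mu>) \<sigma>"
    and Xi: "closed \<Xi>" and pos: "(INF P\<in>mean_dispersion_set D d \<mu> \<sigma>. measure P \<Xi>) > 0"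
    and f: "\<And>\<nu> x. \<nu> \<in> V \<Longrightarrow> (\<exists>l\<in>L. f \<nu> x = s l \<nu> \<bullet> x + t l \<nu>) \<and>
                            (\<forall>l\<in>L. s l \<nu> \<bullet> x + t l \<nu> \<le> f \<nu> x)"
  shows "cdro_value V (mean_dispersion_set D d \<mu> \<sigma>) f \<Xi> = silp_value V L s t D d \<Xi> \<mu> \<sigma>"
proof -
  let ?P = "mean_dispersion_set D d \<mu> \<sigma>"
  let ?F = "silp_feasible V L s t D d \<Xi> \<mu> \<sigma>"
  have cd: "continuous_on UNIV d" by (rule continuous_on_cone_convex[OF D d])
  then have md: "d \<in> borel_measurable borel" by (rule borel_measurable_continuous_onI)
  have D0: "0 \<in> D"
    using D interior_subset cone_contains_0 by (fastforce simp: proper_cone_def)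
  have mXi: "\<Xi> \<in> sets borel" using Xi by simp
  have mf: "f \<nu> \<in> borel_measurable borel" if "\<nu> \<in> V" for \<nu>
    by (rule borel_measurable_continuous_onI, rule continuous_on_max_affine) (rule f[OF that])
  have p: "0 < measure P \<Xi>" if "P \<in> ?P" for P
  proof -
    have "bdd_below ((\<lambda>P. measure P \<Xi>) ` ?P)" by (auto intro!: bdd_belowI[of _ 0])
    then show ?thesis using pos cINF_lower[of "\<lambda>P. measure P \<Xi>" ?P P] that by linarith
  qed
  have feas: "(\<nu>, l0, l1, l2, l3) \<in> ?F \<longleftrightarrow>
      l2 \<in> dual_cone D \<and> l0 + l1 \<bullet> \<mu> + l2 \<bullet> \<sigma> \<le> 0 \<and>
      (\<forall>x. (f \<nu> x - l3) * indicator \<Xi> x \<le> l0 + l1 \<bullet> x + l2 \<bullet> d x)"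
    if "\<nu> \<in> V" for \<nu> l0 l1 l2 l3
    by (rule silp_feasible_iff_majorant[OF cd D0 that]) (rule f[OF that])
  show ?thesis
  proof (rule antisym)
    show "cdro_value V ?P f \<Xi> \<le> silp_value V L s t D d \<Xi> \<mu> \<sigma>"
      unfolding silp_value_def
    proof (rule INF_greatest, clarify)
      fix \<nu> l0 l1 l2 l3 assume mem: "(\<nu>, l0, l1, l2, l3) \<in> ?F"
      then have \<nu>: "\<nu> \<in> V" by (simp add: silp_feasible_def)
      \<comment> \<open>Any piece of the maximum serves as the affine minorant.\<close>
      obtain l where "l \<in> L" using f[OF \<nu>] by blast
      then have "cond_expectation P (f \<nu>) \<Xi> \<le> ereal l3" if "P \<in> ?P" for P
        using mem f[OF \<nu>] unfolding feas[OF \<nu>]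
        by (intro moment_weak_duality[OF that p[OF that] mXi mf[OF \<nu>],
              where p = "s l \<nu>" and r = "t l \<nu>"]) auto
      then have "(SUP P\<in>?P. cond_expectation P (f \<nu>) \<Xi>) \<le> ereal l3" by (rule SUP_least)
      then show "cdro_value V ?P f \<Xi> \<le> ereal l3"
        unfolding cdro_value_def by (rule INF_lower2[OF \<nu>])
    qed
    show "silp_value V L s t D d \<Xi> \<mu> \<sigma> \<le> cdro_value V ?P f \<Xi>"
      unfolding cdro_value_def
    proof (rule INF_greatest, rule ereal_le_real)
      fix \<nu> l3 assume \<nu>: "\<nu> \<in> V" and sup: "(SUP P\<in>?P. cond_expectation P (f \<nu>) \<Xi>) \<le> ereal l3"
      have "cond_expectation P (f \<nu>) \<Xi> \<le> ereal l3" if "P \<in> ?P" for P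
        by (rule order_trans[OF SUP_upper[OF that] sup])
      from conditional_strong_duality[OF D md slater mXi mf[OF \<nu>] p this]
      obtain l0 l1 l2 where "(\<nu>, l0, l1, l2, l3) \<in> ?F"
        unfolding feas[OF \<nu>] by blast
      then show "silp_value V L s t D d \<Xi> \<mu> \<sigma> \<le> ereal l3"
        unfolding silp_value_def by (rule INF_lower2) simp
    qed
  qed
qed

section \<open>Conic reformulation\<close>

text \<open>By homogeneity, nonnegativity of \<open>a \<bullet> x + b \<bullet> u + c\<close> on \<open>S\<close>, the slice \<open>w = 1\<close>, carries over to
  all \<open>w > 0\<close>; closed halfspaces are not affected by the closure in the perspective cone.\<close>

lemma dual_perspective_cone_iff:
  "(a, b, c) \<in> dual_cone (perspective_cone S) \<longleftrightarrow> (\<forall>(x, u)\<in>S. 0 \<le> a \<bullet> x + b \<bullet> u + c)" (is "?L \<longleftrightarrow> ?R")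
proof
  assume L: ?L
  have "0 \<le> a \<bullet> x + b \<bullet> u + c" if "(x, u) \<in> S" for x u
  proof -
    have "(x, u, 1) \<in> perspective_cone S"
      unfolding perspective_cone_def by (rule subsetD[OF closure_subset]) (simp add: that)
    then have "0 \<le> (a, b, c) \<bullet> (x, u, 1)" using L by (simp only: dual_cone_def) blast
    then show ?thesis by simp
  qed
  then show ?R by blast
next
  assume R: ?R
  let ?H = "{z. 0 \<le> (a, b, c) \<bullet> z}"
  have "0 \<le> a \<bullet> x + b \<bullet> u + c * w" if "(x /\<^sub>R w, u /\<^sub>R w) \<in> S" "w > 0" for x u w
  proof -
    have "0 \<le> w * (a \<bullet> (x /\<^sub>R w) + b \<bullet> (u /\<^sub>R w) + c)"
      using R that by (intro mult_nonneg_nonneg) auto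
    also have "\<dots> = (w * inverse w) * (a \<bullet> x) + (w * inverse w) * (b \<bullet> u) + c * w"
      by (simp add: algebra_simps)
    finally show ?thesis using that by simp
  qed
  then have "perspective_cone S \<subseteq> ?H"
    unfolding perspective_cone_def by (intro closure_minimal closed_halfspace_ge) (auto simp: algebra_simps)
  then show ?L by (auto simp: dual_cone_def)
qed

lemma affine_aux_no_auxiliary:
  "affine_aux 0 (\<lambda>x v. g x) \<longleftrightarrow> affine_map g"
  by (simp add: affine_aux_def affine_map_def)

lemma affine_map_linear: "linear A \<Longrightarrow> affine_map A"
  unfolding affine_map_def by (intro exI[of _ A] exI[of _ 0]) simp

lemma affine_map_compose_linear:
  assumes "affine_map g" "linear h" shows "affine_map (\<lambda>x. g (h x))"
proof -
  obtain A b where A: "linear A" "\<And>x. g x = A x + b" using assms(1) by (auto simp: affine_map_def)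
  show ?thesis unfolding affine_map_def
    by (intro exI[of _ "\<lambda>x. A (h x)"] exI[of _ b]) (use A linear_compose[OF assms(2) A(1)] in \<open>auto simp: o_def\<close>)
qed

lemma affine_map_add:
  assumes "affine_map g" "affine_map h" shows "affine_map (\<lambda>x. g x + h x)"
proof -
  obtain A b B c where "linear A" "\<And>x. g x = A x + b" "linear B" "\<And>x. h x = B x + c"
    using assms by (auto simp: affine_map_def)
  then show ?thesis unfolding affine_map_def
    by (intro exI[of _ "\<lambda>x. A x + B x"] exI[of _ "b + c"]) (auto intro: linear_compose_add)
qed

lemma affine_map_diff:
  assumes "affine_map g" "affine_map h" shows "affine_map (\<lambda>x. g x - h x)"
proof -
  obtain A b B c where "linear A" "\<And>x. g x = A x + b" "linear B" "\<And>x. h x = B x + c"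
    using assms by (auto simp: affine_map_def)
  then show ?thesis unfolding affine_map_def
    by (intro exI[of _ "\<lambda>x. A x - B x"] exI[of _ "b - c"]) (auto intro: linear_compose_sub)
qed

lemma affine_map_Pair:
  assumes "affine_map g" "affine_map h" shows "affine_map (\<lambda>x. (g x, h x))"
proof -
  obtain A b B c where "linear A" "\<And>x. g x = A x + b" "linear B" "\<And>x. h x = B x + c"
    using assms by (auto simp: affine_map_def)
  then show ?thesis unfolding affine_map_def
    by (intro exI[of _ "\<lambda>x. (A x, B x)"] exI[of _ "(b, c)"])
      (auto simp: linear_iff)
qed

text \<open>The coefficient vectors of the constraints over \<open>C\<close> (one for each piece \<open>l\<close>) and over \<open>Cbar\<close> depend
  affinely on the tuple of variables, so the system consists of one scalar inequality and of
  memberships in the dual cones, without auxiliary variables.\<close>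

lemma silp_feasible_conic_reformulation:
  fixes V :: "'v::euclidean_space set" and d :: "'a::euclidean_space \<Rightarrow> 'b::euclidean_space"
  assumes L: "finite L" and s: "\<And>l. l \<in> L \<Longrightarrow> affine_map (s l)" and t: "\<And>l. l \<in> L \<Longrightarrow> affine_map (t l)"
  shows "conic_reformulation V (silp_feasible V L s t D d \<Xi> \<mu> \<sigma>) (dual_cone D)
    (dual_cone (perspective_cone (C_set D d \<Xi>))) (dual_cone (perspective_cone (Cbar_set d \<Xi>)))"
proof -
  obtain enum where "bij_betw enum {..<card L} L"
    using L bij_betw_from_nat_into_finite by blast
  then have enum: "enum ` {..<card L} = L" by (rule bij_betw_imp_surj_on)
  let ?\<nu> = "\<lambda>\<xi> :: 'v \<times> real \<times> 'a \<times> 'b \<times> real. fst \<xi>"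
  let ?l0 = "\<lambda>\<xi> :: 'v \<times> real \<times> 'a \<times> 'b \<times> real. fst (snd \<xi>)"
  let ?l1 = "\<lambda>\<xi> :: 'v \<times> real \<times> 'a \<times> 'b \<times> real. fst (snd (snd \<xi>))"
  let ?l2 = "\<lambda>\<xi> :: 'v \<times> real \<times> 'a \<times> 'b \<times> real. fst (snd (snd (snd \<xi>)))"
  let ?l3 = "\<lambda>\<xi> :: 'v \<times> real \<times> 'a \<times> 'b \<times> real. snd (snd (snd (snd \<xi>)))"
  define h where "h = (\<lambda>\<xi>. ?l0 \<xi> + ?l1 \<xi> \<bullet> \<mu> + ?l2 \<xi> \<bullet> \<sigma>)"
  define b where "b = (\<lambda>i \<xi>. (?l1 \<xi> - s (enum i) (?\<nu> \<xi>), ?l2 \<xi>, ?l0 \<xi> + ?l3 \<xi> - t (enum i) (?\<nu> \<xi>)))"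
  define c where "c = (\<lambda>\<xi>. (?l1 \<xi>, ?l2 \<xi>, ?l0 \<xi>))"
  have lin: "linear ?\<nu>" "linear ?l0" "linear ?l1" "linear ?l2" "linear ?l3"
    by (auto simp: linear_iff)
  have "linear h" "linear c" by (auto simp: h_def c_def linear_iff algebra_simps inner_add_left)
  then have hc: "affine_map h" "affine_map c" by (auto intro: affine_map_linear)
  have b: "affine_map (b i)" if "i < card L" for i
  proof -
    have "enum i \<in> L" using enum that by auto
    then show ?thesis unfolding b_def
      by (intro affine_map_Pair affine_map_diff affine_map_add affine_map_compose_linear[OF s lin(1)]
          affine_map_compose_linear[OF t lin(1)] affine_map_linear lin)
  qed
  have eq: "silp_feasible V L s t D d \<Xi> \<mu> \<sigma> =
    {\<xi>. fst \<xi> \<in> V \<and> h \<xi> \<le> 0 \<and> ?l2 \<xi> \<in> dual_cone D \<and>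
        (\<forall>i<card L. b i \<xi> \<in> dual_cone (perspective_cone (C_set D d \<Xi>))) \<and>
        c \<xi> \<in> dual_cone (perspective_cone (Cbar_set d \<Xi>))}" (is "_ = ?R")
  proof -
    have "(\<nu>, l0, l1, l2, l3) \<in> silp_feasible V L s t D d \<Xi> \<mu> \<sigma> \<longleftrightarrow> (\<nu>, l0, l1, l2, l3) \<in> ?R"
      for \<nu> l0 l1 l2 l3
    proof -
      have "(\<forall>i<card L. b i (\<nu>, l0, l1, l2, l3) \<in> dual_cone (perspective_cone (C_set D d \<Xi>))) \<longleftrightarrow>
        (\<forall>l\<in>enum ` {..<card L}. \<forall>(x, u)\<in>C_set D d \<Xi>. 0 \<le> (l1 - s l \<nu>) \<bullet> x + l2 \<bullet> u + (l0 + l3 - t l \<nu>))"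
        by (simp add: b_def dual_perspective_cone_iff Ball_def image_iff) blast
      also have "\<dots> \<longleftrightarrow> (\<forall>(x, u)\<in>C_set D d \<Xi>. \<forall>l\<in>L. l0 + l1 \<bullet> x + l2 \<bullet> u + l3 \<ge> s l \<nu> \<bullet> x + t l \<nu>)"
        unfolding enum by (fastforce simp: inner_diff_left)
      finally have "(\<forall>i<card L. b i (\<nu>, l0, l1, l2, l3) \<in> dual_cone (perspective_cone (C_set D d \<Xi>))) \<longleftrightarrow>
        (\<forall>(x, u)\<in>C_set D d \<Xi>. \<forall>l\<in>L. l0 + l1 \<bullet> x + l2 \<bullet> u + l3 \<ge> s l \<nu> \<bullet> x + t l \<nu>)" .
      moreover have "c (\<nu>, l0, l1, l2, l3) \<in> dual_cone (perspective_cone (Cbar_set d \<Xi>)) \<longleftrightarrow>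
        (\<forall>(x, u) \<in> Cbar_set d \<Xi>. l0 + l1 \<bullet> x + l2 \<bullet> u \<ge> 0)"
        unfolding c_def fst_conv snd_conv dual_perspective_cone_iff by (simp add: algebra_simps)
      ultimately show ?thesis by (auto simp: silp_feasible_def h_def)
    qed
    then show ?thesis by (intro set_eqI) (simp only: split_paired_all)
  qed
  show ?thesis
    unfolding conic_reformulation_def
    by (rule exI[of _ 0], rule exI[of _ 0], rule exI[of _ 1], rule exI[of _ 1], rule exI[of _ "card L"],
        rule exI[of _ 1], rule exI[of _ "\<lambda>i \<xi> v. 0"], rule exI[of _ "\<lambda>i \<xi> v. h \<xi>"],
        rule exI[of _ "\<lambda>i \<xi> v. ?l2 \<xi>"], rule exI[of _ "\<lambda>i \<xi> v. b i \<xi>"], rule exI[of _ "\<lambda>i \<xi> v. c \<xi>"])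
      (use hc b lin in \<open>simp add: affine_aux_no_auxiliary affine_map_linear eq\<close>)
qed

theorem theorem3:
  fixes V :: "(real ^ 'p) set"
    and L :: "'l set"
    and s :: "'l \<Rightarrow> real ^ 'p \<Rightarrow> (real ^ 'ny) \<times> (real ^ 'nz)"
    and t :: "'l \<Rightarrow> real ^ 'p \<Rightarrow> real"
    and f :: "real ^ 'p \<Rightarrow> (real ^ 'ny) \<times> (real ^ 'nz) \<Rightarrow> real"
    and D :: "(real ^ 'm) set"
    and d :: "(real ^ 'ny) \<times> (real ^ 'nz) \<Rightarrow> real ^ 'm"
    and \<Xi> \<X> :: "((real ^ 'ny) \<times> (real ^ 'nz)) set"
    and \<Xi>z :: "(real ^ 'nz) set"
    and \<mu> :: "(real ^ 'ny) \<times> (real ^ 'nz)"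
    and \<sigma> :: "real ^ 'm"
  defines "\<P> \<equiv> mean_dispersion_set D d \<mu> \<sigma>"
    and "K \<equiv> perspective_cone (C_set D d \<Xi>)"
    and "Kbar \<equiv> perspective_cone (Cbar_set d \<Xi>)"
  assumes V: "closed V" "convex V"
    and side_information: "\<Xi> = {(y, z). z \<in> \<Xi>z}"
    and C1: "closed \<Xi>" "convex \<Xi>" "(INF P\<in>\<P>. measure P \<Xi>) > 0" "\<X> = UNIV"
    and C2: "proper_cone D" "cone_convex D d" "conic_representable (cone_epigraph D d)"
    and C3: "\<And>\<nu> x. \<nu> \<in> V \<Longrightarrow> (\<exists>l\<in>L. f \<nu> x = s l \<nu> \<bullet> x + t l \<nu>) \<and>
                                 (\<forall>l\<in>L. s l \<nu> \<bullet> x + t l \<nu> \<le> f \<nu> x)"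
            "\<And>l. l \<in> L \<Longrightarrow> affine_map (s l)" "\<And>l. l \<in> L \<Longrightarrow> affine_map (t l)"
    and C4: "\<mu> \<in> interior \<X>" "cone_less D (d \<mu>) \<sigma>"
  shows "cdro_value V \<P> f \<Xi> = silp_value V L s t D d \<Xi> \<mu> \<sigma> \<and>
    (finite L \<and>
     proper_cone K \<and> proper_cone Kbar \<and>
     conic_representable K \<and> conic_representable (dual_cone K) \<and>
     conic_representable Kbar \<and> conic_representable (dual_cone Kbar) \<and>
     (\<exists>x u. (x, u, 1) \<in> interior K) \<and> (\<exists>x u. (x, u, 1) \<in> interior Kbar)
     \<longrightarrow> conic_reformulation V (silp_feasible V L s t D d \<Xi> \<mu> \<sigma>)
           (dual_cone D) (dual_cone K) (dual_cone Kbar))"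
proof (intro conjI impI)
  show "cdro_value V \<P> f \<Xi> = silp_value V L s t D d \<Xi> \<mu> \<sigma>"
    unfolding \<P>_def
    by (rule cdro_value_eq_silp_value[OF C2(1,2) C4(2) C1(1) C1(3)[unfolded \<P>_def]]) (rule C3(1))
next
  assume "finite L \<and>
     proper_cone K \<and> proper_cone Kbar \<and>
     conic_representable K \<and> conic_representable (dual_cone K) \<and>
     conic_representable Kbar \<and> conic_representable (dual_cone Kbar) \<and>
     (\<exists>x u. (x, u, 1) \<in> interior K) \<and> (\<exists>x u. (x, u, 1) \<in> interior Kbar)"
  then have "finite L" by blast
  then show "conic_reformulation V (silp_feasible V L s t D d \<Xi> \<mu> \<sigma>)
           (dual_cone D) (dual_cone K) (dual_cone Kbar)"
    unfolding K_def Kbar_def by (rule silp_feasible_conic_reformulation[OF _ C3(2,3)])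
qed

end
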